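(* For every odd integer $t\geq 1$ and every integer $n\geq 0$, \begin{align*} \overline{p}_{-t}(8n+1) &\equiv 0 \pmod{2}, & \overline{p}_{-t}(8n+2) &\equiv 0 \pmod{4}, & \overline{p}_{-t}(8n+3) &\equiv 0 \pmod{8}, \\ \overline{p}_{-t}(8n+4) &\equiv 0 \pmod{2}, & \overline{p}_{-t}(8n+5) &\equiv 0 \pmod{8}, & \overline{p}_{-t}(8n+6) &\equiv 0 \pmod{8}, \\ \overline{p}_{-t}(8n+7) &\equiv 0 \pmod{32}. & & & & \end{align*}
   Context: For a positive integer $r$, let $f_r=\prod_{m\geq 1}(1-q^{rm})$ (as a formal power series in $q$). For a positive integer $t$, $\overline{p}_{-t}(n)$ denotes the number of $t$-colored overpartitions of $n$; equivalently, it is defined by the generating function $$\sum_{n\geq 0}\overline{p}_{-t}(n)q^n=\left(\frac{f_2}{f_1^{2}}\right)^t,$$ so in particular $\overline{p}_{-t}(0)=1$. (An overpartition of $n$ is a partition of $n$ in which the first occurrence of each part size may be overlined; its generating function is $f_2/f_1^2$.) *)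

theory Defs
  imports "HOL-Analysis.Analysis" "HOL-Number_Theory.Cong"
begin

text \<open>The infinite product is the limit in the metric topology on formal power series
  (coefficientwise eventual stabilisation); the index is shifted so that it runs over all
  positive integers. Only \<open>r \<ge> 1\<close> is meaningful.\<close>

definition euler_f :: "nat \<Rightarrow> int fps" where
  "euler_f r = prodinf (\<lambda>m. 1 - fps_X ^ (r * Suc m))"

text \<open>Since \<^typ>\<open>int\<close> has no \<open>inverse\<close> operation, the quotient is formed with the library's
  \<open>fps_right_inverse F 1\<close>, which is the reciprocal of any power series \<open>F\<close> with constant
  coefficient 1 (over a commutative ring the left and right inverses agree).\<close>

definition overpartition_gf :: "int fps" where
  "overpartition_gf = euler_f 2 * fps_right_inverse ((euler_f 1)\<^sup>2) 1"

definition colored_overpartitions :: "nat \<Rightarrow> nat \<Rightarrow> int" where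
  "colored_overpartitions t n = fps_nth (overpartition_gf ^ t) n"

text \<open>The product converges and the quotient is a genuine one, so no default values of
  \<^const>\<open>prodinf\<close> or of the right inverse enter.\<close>

lemma
  assumes "r \<ge> 1"
  shows euler_f_has_prod: "(\<lambda>m. 1 - fps_X ^ (r * Suc m)) has_prod euler_f r"
    and euler_f_nth_0: "fps_nth (euler_f r) 0 = 1"
proof -
  define a :: "nat \<Rightarrow> int fps" where "a = (\<lambda>m. 1 - fps_X ^ (r * Suc m))"
  define P where "P = (\<lambda>n. \<Prod>i\<le>n. a i)"
  define L where "L = Abs_fps (\<lambda>k. fps_nth (P k) k)"
  have step: "fps_nth (P (Suc n)) k = fps_nth (P n) k" if "k \<le> n" for n k
  proof -
    have "k < r * Suc (Suc n)"
      using that assms by (metis le_imp_less_Suc less_SucI less_le_trans mult_le_mono1 mult_1)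
    moreover have "P (Suc n) = P n - P n * fps_X ^ (r * Suc (Suc n))"
      by (simp add: P_def a_def right_diff_distrib del: mult_Suc_right)
    ultimately show ?thesis
      by (simp add: fps_X_power_mult_right_nth del: mult_Suc_right)
  qed
  have stable: "fps_nth (P n) k = fps_nth L k" if "k \<le> n" for n k
    using that by (induction n rule: dec_induct) (simp_all add: L_def step)
  have "P \<longlonglongrightarrow> L"
    by (rule tendsto_fpsI) (auto simp: eventually_sequentially intro: stable)
  moreover have L0: "fps_nth L 0 = 1"
    using assms by (simp add: L_def P_def a_def)
  moreover from L0 have "L \<noteq> 0" by auto
  ultimately have "a has_prod L"
    by (simp add: has_prod_def raw_has_prod_def P_def)
  moreover from this have "euler_f r = L"
    unfolding euler_f_def a_def[symmetric] by (rule has_prod_unique[symmetric])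
  ultimately show "(\<lambda>m. 1 - fps_X ^ (r * Suc m)) has_prod euler_f r"
    and "fps_nth (euler_f r) 0 = 1"
    using L0 by (simp_all add: a_def)
qed

lemma overpartition_gf_mult: "(euler_f 1)\<^sup>2 * overpartition_gf = euler_f 2"
proof -
  have "(euler_f 1)\<^sup>2 * fps_right_inverse ((euler_f 1)\<^sup>2) 1 = 1"
    by (rule fps_right_inverse) (simp add: euler_f_nth_0 power2_eq_square)
  then show ?thesis
    by (simp add: overpartition_gf_def mult.left_commute)
qed

end

theory Submission
  imports Defs
begin

text \<open>By Gauss, the reciprocal of \<open>f\<^sub>2 / f\<^sub>1\<^sup>2\<close> is \<open>1 + 2 S\<close> with
  \<open>S = (\<Sum>m\<ge>1. (-1)\<^sup>m q\<^bsup>m\<^sup>2\<^esup>)\<close>; this is obtained as the limit of an identity in the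
  style of Shanks, valid for the partial sums and provable by telescoping. Hence
  \<open>(f\<^sub>2 / f\<^sub>1\<^sup>2)\<^sup>t\<close> is, modulo 32, an integral combination of the \<open>(2 S)\<^sup>j\<close> with
  \<open>j \<le> 4\<close>. Squares are \<open>0, 1, 4\<close> modulo 8, so for most residues of the exponent the
  coefficients of \<open>S\<^sup>j\<close> vanish for small \<open>j\<close>. For the residues 5 and 7 the first
  surviving terms are \<open>S\<^sup>2\<close> and \<open>S\<^sup>4\<close>; there odd and even squares must both occur,
  so that only mixed terms of the binomial expansion contribute, whose coefficients are even.\<close>

section \<open>Gauss's identity\<close>

text \<open>\<open>h i\<close> stands for the reciprocal of \<open>1 + x ^ i\<close>; it is a
  parameter because a commutative ring need not have division. For \<open>s = 0\<close> this is then
  the finite form of \<open>f_1^2 / f_2\<close>.\<close>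

definition euler_ratio_prod :: "'a::comm_ring_1 \<Rightarrow> (nat \<Rightarrow> 'a) \<Rightarrow> nat \<Rightarrow> nat \<Rightarrow> 'a" where
  "euler_ratio_prod x h s n = (\<Prod>i\<in>{s<..n}. (1 - x ^ i) * h i)"

lemma euler_ratio_prod_self [simp]: "euler_ratio_prod x h n n = 1"
  by (simp add: euler_ratio_prod_def)

lemma euler_ratio_prod_Suc:
  assumes "s \<le> n"
  shows "euler_ratio_prod x h s (Suc n)
           = euler_ratio_prod x h s n * ((1 - x ^ Suc n) * h (Suc n))"
proof -
  have "{s<..Suc n} = insert (Suc n) {s<..n}"
    using assms by auto
  then show ?thesis
    by (simp add: euler_ratio_prod_def mult.commute)
qed

lemma euler_ratio_prod_rec:
  assumes "s < n"
  shows "euler_ratio_prod x h s n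
           = (1 - x ^ Suc s) * h (Suc s) * euler_ratio_prod x h (Suc s) n"
proof -
  have "{s<..n} = insert (Suc s) {Suc s<..n}"
    using assms by auto
  then show ?thesis
    by (simp add: euler_ratio_prod_def)
qed

text \<open>With \<open>h i = 1 / (1 + x\<^sup>i)\<close>, every summand of the sum on the left is divisible by \<open>x\<^bsup>n+1\<^esup>\<close>,
  so that the partial products and the partial theta sums have the same limit.\<close>

lemma shanks_square_identity:
  fixes x :: "'a::comm_ring_1"
  assumes h: "\<And>i. i \<ge> 1 \<Longrightarrow> h i * (1 + x ^ i) = 1"
  shows "euler_ratio_prod x h 0 n
           + 2 * (\<Sum>s<n. (-1) ^ Suc s * h (Suc s) * euler_ratio_prod x h (Suc s) n
                          * x ^ (Suc s * Suc n))
         = 1 + 2 * (\<Sum>s<n. (-1) ^ Suc s * x ^ (Suc s)\<^sup>2)"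
proof (induction n)
  case 0
  then show ?case by simp
next
  case (Suc n)
  let ?R = "euler_ratio_prod x h"
  \<comment> \<open>When \<open>n\<close> grows by one, each \<open>u s n\<close> changes by
    \<open>K\<close> times a difference of consecutive \<open>U\<close>, so the changes telescope
    over \<open>s\<close>.\<close>
  define u where "u s n = (-1) ^ Suc s * h (Suc s) * ?R (Suc s) n * x ^ (Suc s * Suc n)" for s n
  define U where "U s = (-1) ^ s * ?R s n * x ^ (Suc s * Suc n)" for s
  define K where "K = h (Suc n)"
  define b where "b = x ^ Suc n"
  have K: "K * (1 + b) = 1"
    unfolding K_def b_def by (rule h) simp
  have step: "u s (Suc n) = u s n + K * (U s - U (Suc s))" if "s < n" for s
  proof -
    define a where "a = x ^ Suc s"
    define c where "c = x ^ (Suc s * Suc n)"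
    define H where "H = h (Suc s)"
    define r where "r = ?R (Suc s) n"
    define e :: 'a where "e = (-1) ^ s"
    have H: "H * (1 + a) = 1"
      unfolding H_def a_def by (rule h) simp
    have 1: "u s (Suc n) = - e * H * (r * ((1 - b) * K)) * (c * a)"
      using that unfolding u_def a_def b_def c_def H_def r_def e_def K_def
      by (simp add: euler_ratio_prod_Suc power_add mult_ac del: power_Suc)
         (simp add: mult_ac power_add)
    have 2: "u s n = - e * H * r * c"
      unfolding u_def c_def H_def r_def e_def by simp
    have 3: "U s = e * ((1 - a) * H * r) * c"
      using that unfolding U_def a_def c_def H_def r_def e_def
      by (simp add: euler_ratio_prod_rec)
    have 4: "U (Suc s) = - e * r * (c * b)"
      unfolding U_def b_def c_def r_def e_def
      by (simp add: power_add mult_ac)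
    \<comment> \<open>Writing 1 as \<open>K * (1 + b)\<close> makes every term a multiple of
      \<open>H * K\<close>; the terms in \<open>b\<close> then combine to
      \<open>b * (H * (1 + a)) = b\<close>.\<close>
    have "H * (a * (1 - b) * K - 1) = H * (a * (1 - b) * K) - H * (K * (1 + b))"
      unfolding K by (simp add: right_diff_distrib)
    also have "\<dots> = - (K * ((1 - a) * H + b * (H * (1 + a))))"
      by (simp add: algebra_simps)
    also have "\<dots> = - (K * ((1 - a) * H + b))"
      unfolding H by simp
    finally have key: "H * (a * (1 - b) * K - 1) = - (K * ((1 - a) * H + b))" .
    have "u s (Suc n) = u s n - e * r * c * (H * (a * (1 - b) * K - 1))"
      unfolding 1 2 by (simp add: algebra_simps)
    also have "\<dots> = u s n + K * (U s - U (Suc s))"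
      unfolding key 3 4 by (simp add: algebra_simps)
    finally show ?thesis .
  qed
  have "(\<Sum>s<n. u s (Suc n)) = (\<Sum>s<n. u s n) + K * (\<Sum>s<n. U s - U (Suc s))"
    by (simp add: step sum.distrib sum_distrib_left)
  also have "(\<Sum>s<n. U s - U (Suc s)) = U 0 - U n"
    by (rule sum_lessThan_telescope')
  finally have tel: "(\<Sum>s<n. u s (Suc n)) = (\<Sum>s<n. u s n) + K * (U 0 - U n)" .
  define p where "p = ?R 0 n"
  define w where "w = x ^ (Suc n)\<^sup>2"
  define e :: 'a where "e = (-1) ^ n"
  have U0: "U 0 = p * b" and Un: "U n = e * w"
    by (simp_all add: U_def p_def b_def w_def e_def power2_eq_square)
  have R: "?R 0 (Suc n) = p * ((1 - b) * K)"
    unfolding p_def b_def K_def by (rule euler_ratio_prod_Suc) simp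
  have last: "u n (Suc n) = - e * K * (w * b)"
    unfolding u_def e_def K_def w_def b_def by (simp add: power_add power2_eq_square mult_ac)
  have IH: "p + 2 * (\<Sum>s<n. u s n) = 1 + 2 * (\<Sum>s<n. (-1) ^ Suc s * x ^ (Suc s)\<^sup>2)"
    using Suc.IH unfolding u_def p_def .
  \<comment> \<open>The boundary term \<open>U 0\<close> turns the factor \<open>1 - b\<close> of
    the new product into \<open>1 + b\<close>, and \<open>U n\<close> joins the last summand in the
    same way; \<open>K\<close> cancels both and leaves the new theta term.\<close>
  have "?R 0 (Suc n) + 2 * (\<Sum>s<Suc n. u s (Suc n))
          = (K * (1 + b)) * p + 2 * (\<Sum>s<n. u s n) - 2 * e * w * (K * (1 + b))"
    unfolding sum.lessThan_Suc tel R last U0 Un by (simp add: algebra_simps)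
  also have "\<dots> = (p + 2 * (\<Sum>s<n. u s n)) + 2 * (- e * w)"
    unfolding K by simp
  also have "\<dots> = 1 + 2 * (\<Sum>s<Suc n. (-1) ^ Suc s * x ^ (Suc s)\<^sup>2)"
    unfolding IH by (simp add: e_def w_def algebra_simps)
  finally show ?case
    unfolding u_def .
qed

section \<open>The theta series and the passage to the limit\<close>

text \<open>The sign can be read off the exponent, as \<open>m\<close> and \<open>m^2\<close> have
  the same parity. \<open>1 + 2 * square_series\<close> is the theta series of
  \<open>(-1)^m q^(m^2)\<close> over all integers \<open>m\<close>.\<close>

definition square_series :: "int fps" where
  "square_series = Abs_fps (\<lambda>k. if k > 0 \<and> (\<exists>m. k = m\<^sup>2) then (-1) ^ k else 0)"

lemma square_partial_sum_nth:
  assumes "k \<le> n"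
  shows "fps_nth (\<Sum>s<n. (-1) ^ Suc s * fps_X ^ (Suc s)\<^sup>2) k = fps_nth square_series k"
proof -
  have "fps_nth ((-1) ^ Suc s * fps_X ^ (Suc s)\<^sup>2 :: int fps) k
          = (if k = (Suc s)\<^sup>2 then (-1) ^ k else 0)" for s
    by (cases "even s") (simp_all add: fps_X_power_nth)
  then have "fps_nth (\<Sum>s<n. (-1) ^ Suc s * fps_X ^ (Suc s)\<^sup>2) k
          = (\<Sum>s<n. if k = (Suc s)\<^sup>2 then (-1) ^ k else (0::int))"
    by (simp add: fps_sum_nth)
  also have "\<dots> = fps_nth square_series k"
  proof (cases "k > 0 \<and> (\<exists>m. k = m\<^sup>2)")
    case True
    then obtain m where m: "k = m\<^sup>2" "m > 0"
      by auto
    then obtain j where j: "m = Suc j"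
      using gr0_conv_Suc by blast
    have "m \<le> n"
      using assms m by (metis le_trans power2_nat_le_imp_le order_refl)
    moreover have "k = (Suc s)\<^sup>2 \<longleftrightarrow> s = j" for s
      using m j by (metis Suc_inject power2_eq_iff_nonneg zero_le)
    ultimately show ?thesis
      using True j by (simp add: square_series_def)
  next
    case False
    then have "k \<noteq> (Suc s)\<^sup>2" for s
      by auto
    with False show ?thesis
      by (auto simp: square_series_def)
  qed
  finally show ?thesis .
qed

text \<open>A coefficient of a product involves only finitely many coefficients of the factors, and
  these are eventually constant together.\<close>

lemma tendsto_mult_fps:
  fixes f g :: "'b \<Rightarrow> 'a::ring_1 fps"
  assumes "(f \<longlongrightarrow> a) F" and "(g \<longlongrightarrow> b) F"
  shows "((\<lambda>x. f x * g x) \<longlongrightarrow> a * b) F"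
proof (rule tendsto_fpsI)
  fix n
  have "\<forall>\<^sub>F x in F. \<forall>i\<in>{0..n}. fps_nth (f x) i = fps_nth a i"
    using assms(1) by (intro eventually_ball_finite) (auto simp: tendsto_fps_iff)
  moreover have "\<forall>\<^sub>F x in F. \<forall>i\<in>{0..n}. fps_nth (g x) i = fps_nth b i"
    using assms(2) by (intro eventually_ball_finite) (auto simp: tendsto_fps_iff)
  ultimately show "\<forall>\<^sub>F x in F. fps_nth (f x * g x) n = fps_nth (a * b) n"
    by eventually_elim (simp add: fps_mult_nth)
qed

lemma euler_f_LIMSEQ:
  assumes "r \<ge> 1"
  shows "(\<lambda>n. \<Prod>i\<in>{0<..n}. 1 - fps_X ^ (r * i)) \<longlonglongrightarrow> euler_f r"
proof -
  \<comment> \<open>\<open>has_prod\<close> also admits products that become 0 through a zero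
    factor; excluding zero factors leaves the plain limit from index 0.\<close>
  have ne: "\<forall>i. 1 - fps_X ^ (r * Suc i) \<noteq> (0 :: int fps)"
  proof
    fix i
    have "fps_nth (1 - fps_X ^ (r * Suc i) :: int fps) 0 = 1"
      using assms by simp
    then show "1 - fps_X ^ (r * Suc i) \<noteq> (0 :: int fps)"
      by (metis fps_zero_nth zero_neq_one)
  qed
  have "raw_has_prod (\<lambda>m. 1 - fps_X ^ (r * Suc m) :: int fps) 0 (euler_f r)"
    using euler_f_has_prod[OF assms] ne unfolding has_prod_def by metis
  then have "(\<lambda>n. \<Prod>i\<le>n. 1 - fps_X ^ (r * Suc i)) \<longlonglongrightarrow> euler_f r"
    by (simp add: raw_has_prod_def)
  moreover have "(\<Prod>i\<le>n. 1 - fps_X ^ (r * Suc i)) = (\<Prod>i\<in>{0<..Suc n}. 1 - fps_X ^ (r * i) :: int fps)" for n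
    by (rule prod.reindex_bij_witness[of _ "\<lambda>i. i - 1" Suc]) auto
  ultimately show ?thesis
    by (subst filterlim_sequentially_Suc [symmetric]) simp
qed

text \<open>Factor by factor, \<open>(1 - q^i) / (1 + q^i) * (1 - q^(2i)) = (1 - q^i)^2\<close>. The
  limit of these finite products gives the identity, since the ratio products tend to the theta
  series.\<close>

lemma gauss_square_identity: "(1 + 2 * square_series) * euler_f 2 = (euler_f 1)\<^sup>2"
proof -
  define h :: "nat \<Rightarrow> int fps" where "h i = fps_right_inverse (1 + fps_X ^ i) 1" for i
  \<comment> \<open>For \<open>i = 0\<close> the constant coefficient would be 2, for which 1 is not
    the inverse; hence the bound on \<open>i\<close>.\<close>
  have h: "h i * (1 + fps_X ^ i) = 1" if "i \<ge> 1" for i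
    unfolding h_def mult.commute[of "fps_right_inverse _ _"]
    using that by (intro fps_right_inverse) simp
  define P where "P = euler_ratio_prod fps_X h 0"
  have "P \<longlonglongrightarrow> 1 + 2 * square_series"
  proof (rule tendsto_fpsI)
    fix k
    have "fps_nth (P n) k = fps_nth (1 + 2 * square_series) k" if "k \<le> n" for n
    proof -
      let ?E = "\<Sum>s<n. (-1) ^ Suc s * h (Suc s) * euler_ratio_prod fps_X h (Suc s) n
                          * fps_X ^ (Suc s * Suc n)"
      let ?F = "\<Sum>s<n. (-1) ^ Suc s * fps_X ^ (Suc s)\<^sup>2 :: int fps"
      have "k < Suc s * Suc n" for s
        using that by simp
      then have E: "fps_nth ?E k = 0"
        by (simp add: fps_sum_nth fps_X_power_mult_right_nth del: mult_Suc mult_Suc_right)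
      have "P n = 1 + 2 * ?F - 2 * ?E"
        using shanks_square_identity[of h fps_X n] h unfolding P_def by (simp add: eq_diff_eq)
      then show ?thesis
        using E square_partial_sum_nth[OF that]
        by (simp add: numeral_fps_const del: power_Suc mult_Suc mult_Suc_right)
    qed
    then show "\<forall>\<^sub>F n in sequentially. fps_nth (P n) k = fps_nth (1 + 2 * square_series) k"
      unfolding eventually_sequentially by blast
  qed
  then have "(\<lambda>n. P n * (\<Prod>i\<in>{0<..n}. 1 - fps_X ^ (2 * i)))
               \<longlonglongrightarrow> (1 + 2 * square_series) * euler_f 2"
    by (intro tendsto_mult_fps euler_f_LIMSEQ) simp_all
  moreover have "P n * (\<Prod>i\<in>{0<..n}. 1 - fps_X ^ (2 * i))
      = (\<Prod>i\<in>{0<..n}. 1 - fps_X ^ (1 * i)) * (\<Prod>i\<in>{0<..n}. 1 - fps_X ^ (1 * i))" for n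
  proof -
    have "(1 - fps_X ^ i) * h i * (1 - fps_X ^ (2 * i)) = (1 - fps_X ^ i) * (1 - fps_X ^ i)"
      if "i \<ge> 1" for i
    proof -
      have "(1 - fps_X ^ i) * h i * (1 - fps_X ^ (2 * i))
              = (1 - fps_X ^ i) * (h i * (1 + fps_X ^ i)) * (1 - fps_X ^ i)"
        unfolding mult_2 power_add by (simp add: algebra_simps)
      then show ?thesis
        by (simp add: h[OF that])
    qed
    then show ?thesis
      unfolding P_def euler_ratio_prod_def prod.distrib[symmetric] by (intro prod.cong) simp_all
  qed
  moreover have "(\<lambda>n. (\<Prod>i\<in>{0<..n}. 1 - fps_X ^ (1 * i)) * (\<Prod>i\<in>{0<..n}. 1 - fps_X ^ (1 * i)))
                   \<longlonglongrightarrow> euler_f 1 * euler_f 1"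
    by (intro tendsto_mult_fps euler_f_LIMSEQ) simp_all
  ultimately show ?thesis
    unfolding power2_eq_square by (metis (no_types, lifting) LIMSEQ_unique ext)
qed

text \<open>Both factors link \<open>(euler_f 1)^2\<close> with \<open>euler_f 2\<close>, and the
  latter cancels because integer power series form an integral domain.\<close>

lemma overpartition_gf_mult_theta: "overpartition_gf * (1 + 2 * square_series) = 1"
proof -
  have "euler_f 2 \<noteq> 0"
    using euler_f_nth_0[of 2] by auto
  moreover have "euler_f 2 * (overpartition_gf * (1 + 2 * square_series)) = euler_f 2 * 1"
    using overpartition_gf_mult unfolding gauss_square_identity[symmetric] by (simp add: mult_ac)
  ultimately show ?thesis
    by (metis mult_left_cancel)
qed

section \<open>Expansion modulo 32\<close>

text \<open>Multiplying by \<open>overpartition_gf\<close> is dividing by \<open>1 + 2 S\<close>,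
  which keeps integer coefficients. Degree 4 suffices because \<open>(2 S)^5\<close> is a multiple
  of 32.\<close>

lemma overpartition_gf_power_expansion:
  "\<exists>(a :: int) b c d e W. overpartition_gf ^ t =
     of_int a + of_int b * (2 * square_series) + of_int c * (2 * square_series) ^ 2
     + of_int d * (2 * square_series) ^ 3 + of_int e * (2 * square_series) ^ 4 + 32 * W"
proof (induction t)
  case 0
  show ?case
    by (rule exI[of _ 1], (rule exI[of _ 0])+) simp
next
  case (Suc t)
  define S where "S = square_series"
  define G where "G = overpartition_gf"
  have G: "G * (1 + 2 * S) = 1"
    unfolding S_def G_def by (rule overpartition_gf_mult_theta)
  obtain a b c d e W where IH: "G ^ t = of_int a + of_int b * (2 * S) + of_int c * (2 * S) ^ 2
     + of_int d * (2 * S) ^ 3 + of_int e * (2 * S) ^ 4 + 32 * W"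
    using Suc.IH unfolding S_def G_def by blast
  text \<open>Synthetic division of the expansion by \<open>1 + 2 S\<close>.\<close>
  define b' where "b' = b - a"
  define c' where "c' = c - b'"
  define d' where "d' = d - c'"
  define e' where "e' = e - d'"
  define Q where "Q = of_int a + of_int b' * (2 * S) + of_int c' * (2 * S) ^ 2
     + of_int d' * (2 * S) ^ 3 + of_int e' * (2 * S) ^ 4"
  \<comment> \<open>The division leaves the remainder
    \<open>- e' * (2 S)^5 = - 32 * e' * S^5\<close>, which is absorbed here.\<close>
  define V where "V = W - of_int e' * S ^ 5"
  have "G ^ t = (1 + 2 * S) * Q + 32 * V"
    unfolding IH Q_def V_def e'_def d'_def c'_def b'_def of_int_diff by algebra
  then have "G ^ Suc t = (G * (1 + 2 * S)) * Q + 32 * (G * V)"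
    by (simp add: algebra_simps)
  then have "G ^ Suc t = Q + 32 * (G * V)"
    unfolding G by simp
  then have "G ^ Suc t = of_int a + of_int b' * (2 * S) + of_int c' * (2 * S) ^ 2
     + of_int d' * (2 * S) ^ 3 + of_int e' * (2 * S) ^ 4 + 32 * (G * V)"
    unfolding Q_def .
  then show ?case
    unfolding S_def G_def by blast
qed

lemma fps_nth_numeral_mult: "fps_nth (numeral k * f :: int fps) n = numeral k * fps_nth f n"
  by (simp add: numeral_fps_const)

text \<open>For positive \<open>n\<close> the constant term \<open>a\<close> drops out, so every
  remaining term shows its power of 2.\<close>

lemma colored_overpartitions_expansion:
  assumes "n > 0"
  shows "\<exists>b c d e w. colored_overpartitions t n =
     2 * b * fps_nth square_series n + 4 * c * fps_nth (square_series ^ 2) n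
     + 8 * d * fps_nth (square_series ^ 3) n + 16 * e * fps_nth (square_series ^ 4) n + 32 * w"
proof -
  obtain a b c d e W where "overpartition_gf ^ t = of_int a + of_int b * (2 * square_series)
     + of_int c * (2 * square_series) ^ 2 + of_int d * (2 * square_series) ^ 3
     + of_int e * (2 * square_series) ^ 4 + 32 * W"
    using overpartition_gf_power_expansion by blast
  then have "colored_overpartitions t n = 2 * b * fps_nth square_series n
     + 4 * c * fps_nth (square_series ^ 2) n + 8 * d * fps_nth (square_series ^ 3) n
     + 16 * e * fps_nth (square_series ^ 4) n + 32 * fps_nth W n"
    using assms
    by (simp add: colored_overpartitions_def power_mult_distrib fps_nth_numeral_mult
        flip: fps_of_int)
  then show ?thesis
    by blast
qed

section \<open>Exponents modulo 8\<close>

definition fps_residues_in :: "nat \<Rightarrow> nat set \<Rightarrow> 'a::zero fps \<Rightarrow> bool" where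
  "fps_residues_in m R f \<longleftrightarrow> (\<forall>n. fps_nth f n \<noteq> 0 \<longrightarrow> n mod m \<in> R)"

lemma fps_residues_in_nth:
  assumes "fps_residues_in m R f" and "n mod m \<notin> R"
  shows "fps_nth f n = 0"
  using assms by (auto simp: fps_residues_in_def)

text \<open>A nonzero coefficient of the product needs a nonzero summand in the convolution, whose
  two exponents add up to \<open>n\<close>.\<close>

lemma fps_residues_in_mult:
  fixes f g :: "'a::semiring_0 fps"
  assumes f: "fps_residues_in m A f" and g: "fps_residues_in m B g"
    and AB: "\<And>a b. a \<in> A \<Longrightarrow> b \<in> B \<Longrightarrow> (a + b) mod m \<in> C"
  shows "fps_residues_in m C (f * g)"
  unfolding fps_residues_in_def
proof (intro allI impI)
  fix n
  assume "fps_nth (f * g) n \<noteq> 0"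
  then obtain i where i: "i \<le> n" "fps_nth f i * fps_nth g (n - i) \<noteq> 0"
    unfolding fps_mult_nth by (metis (no_types, lifting) atLeastAtMost_iff sum.neutral)
  from i(2) have "fps_nth f i \<noteq> 0" "fps_nth g (n - i) \<noteq> 0"
    by auto
  then have "i mod m \<in> A" "(n - i) mod m \<in> B"
    using f g by (simp_all add: fps_residues_in_def)
  from AB[OF this] i(1) show "n mod m \<in> C"
    by (simp add: mod_add_eq)
qed

lemma square_mod_8: "(m::nat)\<^sup>2 mod 8 = (if odd m then 1 else if 4 dvd m then 0 else 4)"
proof -
  have "m mod 8 \<in> {0, 1, 2, 3, 4, 5, 6, 7}"
    by auto
  moreover have "m\<^sup>2 mod 8 = (m mod 8)\<^sup>2 mod 8"
    by (simp add: power_mod)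
  moreover have "odd m \<longleftrightarrow> odd (m mod 8)" "4 dvd m \<longleftrightarrow> 4 dvd m mod 8"
    by presburger+
  ultimately show ?thesis
    by auto
qed

text \<open>Separating odd from even squares fixes residues modulo 4: a product with
  \<open>i\<close> factors \<open>A\<close> has only exponents congruent to
  \<open>i\<close>.\<close>

lemma square_series_split:
  obtains A B where "square_series = A + B"
    and "fps_residues_in 8 {1} A" and "fps_residues_in 8 {0, 4} B"
proof
  let ?A = "Abs_fps (\<lambda>k. if odd k then fps_nth square_series k else 0)"
  let ?B = "Abs_fps (\<lambda>k. if even k then fps_nth square_series k else 0)"
  show "square_series = ?A + ?B"
    by (rule fps_ext) simp
  show "fps_residues_in 8 {1} ?A" "fps_residues_in 8 {0, 4} ?B"
    by (auto simp: fps_residues_in_def square_series_def square_mod_8 split: if_splits)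
qed

lemma square_series_nth_eq_0:
  assumes "n mod 8 \<in> {2, 3, 5, 6, 7}"
  shows "fps_nth square_series n = 0"
  using assms by (auto simp: square_series_def square_mod_8 split: if_splits)

lemma square_series_power_nth:
  shows "n mod 8 \<in> {3, 6, 7} \<Longrightarrow> fps_nth (square_series ^ 2) n = 0"
    and "n mod 8 = 5 \<Longrightarrow> even (fps_nth (square_series ^ 2) n)"
    and "n mod 8 = 7 \<Longrightarrow> fps_nth (square_series ^ 3) n = 0"
    and "n mod 8 = 7 \<Longrightarrow> even (fps_nth (square_series ^ 4) n)"
proof -
  obtain A B where S: "square_series = A + B"
    and A: "fps_residues_in 8 {1} A" and B: "fps_residues_in 8 {0, 4} B"
    by (rule square_series_split)
  have AA: "fps_residues_in 8 {2} (A * A)"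
    by (rule fps_residues_in_mult[OF A A]) auto
  have AB: "fps_residues_in 8 {1, 5} (A * B)"
    by (rule fps_residues_in_mult[OF A B]) auto
  have BB: "fps_residues_in 8 {0, 4} (B * B)"
    by (rule fps_residues_in_mult[OF B B]) auto
  have AAA: "fps_residues_in 8 {3} (A * A * A)"
    by (rule fps_residues_in_mult[OF AA A]) auto
  have AAB: "fps_residues_in 8 {2, 6} (A * A * B)"
    by (rule fps_residues_in_mult[OF AA B]) auto
  have ABB: "fps_residues_in 8 {1, 5} (A * B * B)"
    by (rule fps_residues_in_mult[OF AB B]) auto
  have BBB: "fps_residues_in 8 {0, 4} (B * B * B)"
    by (rule fps_residues_in_mult[OF BB B]) auto
  have AAAA: "fps_residues_in 8 {4} (A * A * A * A)"
    by (rule fps_residues_in_mult[OF AAA A]) auto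
  have BBBB: "fps_residues_in 8 {0, 4} (B * B * B * B)"
    by (rule fps_residues_in_mult[OF BBB B]) auto
  have S2: "square_series ^ 2 = A * A + 2 * (A * B) + B * B"
    unfolding S by algebra
  have S3: "square_series ^ 3 = A * A * A + 3 * (A * A * B) + 3 * (A * B * B) + B * B * B"
    unfolding S by algebra
  have S4: "square_series ^ 4 = A * A * A * A + B * B * B * B
      + 2 * (2 * (A * A * A * B) + 3 * (A * A * B * B) + 2 * (A * B * B * B))"
    unfolding S by algebra
  show "fps_nth (square_series ^ 2) n = 0" if "n mod 8 \<in> {3, 6, 7}"
    using that fps_residues_in_nth[OF AA, of n] fps_residues_in_nth[OF AB, of n]
      fps_residues_in_nth[OF BB, of n]
    unfolding S2 fps_add_nth fps_nth_numeral_mult by auto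
  show "even (fps_nth (square_series ^ 2) n)" if "n mod 8 = 5"
    using that fps_residues_in_nth[OF AA, of n] fps_residues_in_nth[OF BB, of n]
    unfolding S2 fps_add_nth fps_nth_numeral_mult by simp
  \<comment> \<open>Here the mixed coefficients are 3, so parity does not help; instead the residues
    3, {2, 6}, {1, 5} and {0, 4} all miss 7.\<close>
  show "fps_nth (square_series ^ 3) n = 0" if "n mod 8 = 7"
    using that fps_residues_in_nth[OF AAA, of n] fps_residues_in_nth[OF AAB, of n]
      fps_residues_in_nth[OF ABB, of n] fps_residues_in_nth[OF BBB, of n]
    unfolding S3 fps_add_nth fps_nth_numeral_mult by simp
  show "even (fps_nth (square_series ^ 4) n)" if "n mod 8 = 7"
    using that fps_residues_in_nth[OF AAAA, of n] fps_residues_in_nth[OF BBBB, of n]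
    \<comment> \<open>The chosen instances of \<open>fps_add_nth\<close> leave the mixed terms in
      one bracket, so that its factor 2 stays visible.\<close>
    unfolding S4 fps_add_nth[of "A * A * A * A + B * B * B * B"]
      fps_add_nth[of "A * A * A * A"] fps_nth_numeral_mult by simp
qed

section \<open>Divisibility in each residue class\<close>

lemma colored_overpartitions_dvd:
  assumes "n > 0"
  shows "2 dvd colored_overpartitions t n"
    and "n mod 8 = 2 \<Longrightarrow> 4 dvd colored_overpartitions t n"
    and "n mod 8 \<in> {3, 5, 6} \<Longrightarrow> 8 dvd colored_overpartitions t n"
    and "n mod 8 = 7 \<Longrightarrow> 32 dvd colored_overpartitions t n"
proof -
  obtain b c d e w where exp: "colored_overpartitions t n =
     2 * b * fps_nth square_series n + 4 * c * fps_nth (square_series ^ 2) n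
     + 8 * d * fps_nth (square_series ^ 3) n + 16 * e * fps_nth (square_series ^ 4) n + 32 * w"
    using colored_overpartitions_expansion[OF assms] by blast
  show "2 dvd colored_overpartitions t n"
    unfolding exp by simp
  show "4 dvd colored_overpartitions t n" if "n mod 8 = 2"
  proof -
    have "fps_nth square_series n = 0"
      using that by (intro square_series_nth_eq_0) simp
    then show ?thesis
      unfolding exp by (simp add: dvd_add dvd_mult2)
  qed
  show "8 dvd colored_overpartitions t n" if "n mod 8 \<in> {3, 5, 6}"
  proof -
    have "fps_nth square_series n = 0"
      using that by (intro square_series_nth_eq_0) auto
    \<comment> \<open>The coefficient vanishes for residues 3 and 6 and is even for 5; in each case
      its weight 4 rises to 8.\<close>
    moreover have "even (fps_nth (square_series ^ 2) n)"
      using that square_series_power_nth(1,2)[of n] by auto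
    then obtain v where "fps_nth (square_series ^ 2) n = 2 * v" ..
    ultimately have "colored_overpartitions t n
        = 8 * (c * v + d * fps_nth (square_series ^ 3) n
               + 2 * e * fps_nth (square_series ^ 4) n + 4 * w)"
      unfolding exp by simp
    then show ?thesis
      by simp
  qed
  show "32 dvd colored_overpartitions t n" if n7: "n mod 8 = 7"
  proof -
    have "fps_nth square_series n = 0"
      using that by (intro square_series_nth_eq_0) simp
    \<comment> \<open>The terms in \<open>S\<close>, \<open>S^2\<close> and \<open>S^3\<close>
      vanish, and evenness raises the weight 16 of \<open>S^4\<close> to 32.\<close>
    moreover obtain v where "fps_nth (square_series ^ 4) n = 2 * v"
      using square_series_power_nth(4)[OF n7] by (rule evenE)
    ultimately have "colored_overpartitions t n = 32 * (e * v + w)"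
      unfolding exp using that by (simp add: square_series_power_nth(1,3))
    then show ?thesis
      by simp
  qed
qed

theorem theorem1p2:
  fixes t n :: nat
  assumes "odd t"
  shows "[colored_overpartitions t (8 * n + 1) = 0] (mod 2) \<and>
         [colored_overpartitions t (8 * n + 2) = 0] (mod 4) \<and>
         [colored_overpartitions t (8 * n + 3) = 0] (mod 8) \<and>
         [colored_overpartitions t (8 * n + 4) = 0] (mod 2) \<and>
         [colored_overpartitions t (8 * n + 5) = 0] (mod 8) \<and>
         [colored_overpartitions t (8 * n + 6) = 0] (mod 8) \<and>
         [colored_overpartitions t (8 * n + 7) = 0] (mod 32)"
  \<comment> \<open>The modulus selects the matching part of
    \<open>colored_overpartitions_dvd\<close>; only positivity and residues of
    \<open>8 * n + k\<close> remain.\<close>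
  unfolding cong_0_iff by (intro conjI colored_overpartitions_dvd) (simp_all del: add_2_eq_Suc')

end
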